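(* Let $k\in[0,1)$ and let $S$ be a weakly regular AG-groupoid with left identity $e$. Then the following conditions are equivalent: (i) $S$ is regular. (ii) $f_k=(f\circ_k 1)\circ_k f$ for every $(\in,\in\vee q_k)$-fuzzy generalized bi-ideal $f$ of $S$. (iii) $f_k=(f\circ_k 1)\circ_k f$ for every $(\in,\in\vee q_k)$-fuzzy bi-ideal $f$ of $S$. (iv) $f_k=(f\circ_k 1)\circ_k f$ for every $(\in,\in\vee q_k)$-fuzzy quasi-ideal $f$ of $S$.
   Context: An AG-groupoid is a (non-empty) set $S$ with a binary operation satisfying $(ab)c=(cb)a$ for all $a,b,c\in S$. A left identity is an element $e$ with $ea=a$ for all $a$. $S$ is weakly regular if for each $a\in S$ there are $x,y\in S$ with $a=(ax)(ay)$; $S$ is regular if for each $a\in S$ there is $x\in S$ with $a=(ax)a$. A fuzzy subset of $S$ is a map $f:S\to[0,1]$; $\wedge$ denotes minimum. $1$ denotes the constant fuzzy subset with value $1$. The product is $(f\circ g)(a)=\sup_{a=bc}\, (f(b)\wedge g(c))$ (supremum over all $b,c\in S$ with $a=bc$), and $(f\circ g)(a)=0$ if $a$ is not a product of two elements. Further, $f_k(a)=f(a)\wedge\frac{1-k}{2}$ and $(f\circ_k g)(a)=(f\circ g)(a)\wedge\frac{1-k}{2}$. For $x\in S$, $t\in(0,1]$: $x_t\in f$ means $f(x)\ge t$; $x_t q_k f$ means $f(x)+t+k>1$; $x_t\in\vee q_k f$ means $x_t\in f$ or $x_tq_kf$. A fuzzy subset $f$ is an $(\in,\in\vee q_k)$-fuzzy: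 - subgroupoid if $x_t\in f$ and $y_r\in f$ imply $(xy)_{t\wedge r}\in\vee q_kf$; equivalently $f(xy)\ge f(x)\wedge f(y)\wedge\frac{1-k}{2}$ for all $x,y$; - generalized bi-ideal if $x_t\in f$ and $z_r\in f$ imply $((xy)z)_{t\wedge r}\in\vee q_kf$ for all $y$; equivalently $f((xy)z)\ge f(x)\wedge f(z)\wedge\frac{1-k}{2}$ for all $x,y,z$; - bi-ideal if it is both an $(\in,\in\vee q_k)$-fuzzy subgroupoid and an $(\in,\in\vee q_k)$-fuzzy generalized bi-ideal; - quasi-ideal if $f(x)\ge (f\circ 1)(x)\wedge(1\circ f)(x)\wedge\frac{1-k}{2}$ for all $x$. *)

theory Defs
  imports Complex_Main
begin

definition ag_groupoid :: "'a set \<Rightarrow> ('a \<Rightarrow> 'a \<Rightarrow> 'a) \<Rightarrow> bool" where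
  "ag_groupoid S m \<longleftrightarrow>
     S \<noteq> {} \<and>
     (\<forall>a\<in>S. \<forall>b\<in>S. m a b \<in> S) \<and>
     (\<forall>a\<in>S. \<forall>b\<in>S. \<forall>c\<in>S. m (m a b) c = m (m c b) a)"

definition left_identity :: "'a set \<Rightarrow> ('a \<Rightarrow> 'a \<Rightarrow> 'a) \<Rightarrow> 'a \<Rightarrow> bool" where
  "left_identity S m e \<longleftrightarrow> e \<in> S \<and> (\<forall>a\<in>S. m e a = a)"

definition weakly_regular :: "'a set \<Rightarrow> ('a \<Rightarrow> 'a \<Rightarrow> 'a) \<Rightarrow> bool" where
  "weakly_regular S m \<longleftrightarrow> (\<forall>a\<in>S. \<exists>x\<in>S. \<exists>y\<in>S. a = m (m a x) (m a y))"

definition regular :: "'a set \<Rightarrow> ('a \<Rightarrow> 'a \<Rightarrow> 'a) \<Rightarrow> bool" where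
  "regular S m \<longleftrightarrow> (\<forall>a\<in>S. \<exists>x\<in>S. a = m (m a x) a)"

text \<open>A fuzzy subset of \<open>S\<close> is represented by a real function on the ambient type whose values
  on \<open>S\<close> lie in the unit interval. Its values outside \<open>S\<close> are irrelevant: the notions below
  evaluate it on \<open>S\<close> only, and equality of fuzzy subsets is equality on \<open>S\<close>.\<close>

definition fuzzy_subset :: "'a set \<Rightarrow> ('a \<Rightarrow> real) \<Rightarrow> bool" where
  "fuzzy_subset S f \<longleftrightarrow> (\<forall>a\<in>S. 0 \<le> f a \<and> f a \<le> 1)"

definition fuzzy_eq :: "'a set \<Rightarrow> ('a \<Rightarrow> real) \<Rightarrow> ('a \<Rightarrow> real) \<Rightarrow> bool" where
  "fuzzy_eq S f g \<longleftrightarrow> (\<forall>a\<in>S. f a = g a)"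

definition fuzzy_one :: "'a \<Rightarrow> real" where
  "fuzzy_one = (\<lambda>a. 1)"

text \<open>The case distinction is needed because \<open>Sup {}\<close> is unspecified on the reals; for fuzzy
  subsets the set in the other branch is nonempty and bounded, so its \<open>Sup\<close> is the true supremum.\<close>

definition fuzzy_prod ::
  "'a set \<Rightarrow> ('a \<Rightarrow> 'a \<Rightarrow> 'a) \<Rightarrow> ('a \<Rightarrow> real) \<Rightarrow> ('a \<Rightarrow> real) \<Rightarrow> 'a \<Rightarrow> real" where
  "fuzzy_prod S m f g a =
     (if \<exists>b\<in>S. \<exists>c\<in>S. a = m b c
      then Sup {min (f b) (g c) | b c. b \<in> S \<and> c \<in> S \<and> a = m b c}
      else 0)"

definition fuzzy_cut :: "real \<Rightarrow> ('a \<Rightarrow> real) \<Rightarrow> 'a \<Rightarrow> real" where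
  "fuzzy_cut k f a = min (f a) ((1 - k) / 2)"

definition fuzzy_prod_k ::
  "'a set \<Rightarrow> ('a \<Rightarrow> 'a \<Rightarrow> 'a) \<Rightarrow> real \<Rightarrow> ('a \<Rightarrow> real) \<Rightarrow> ('a \<Rightarrow> real) \<Rightarrow> 'a \<Rightarrow> real" where
  "fuzzy_prod_k S m k f g a = min (fuzzy_prod S m f g a) ((1 - k) / 2)"

text \<open>For a fuzzy point \<open>x\<^sub>t\<close>: the relations \<open>x\<^sub>t \<in> f\<close>, \<open>x\<^sub>t q\<^sub>k f\<close> and \<open>x\<^sub>t \<in>\<or>q\<^sub>k f\<close>.\<close>

definition pt_in :: "'a \<Rightarrow> real \<Rightarrow> ('a \<Rightarrow> real) \<Rightarrow> bool" where
  "pt_in x t f \<longleftrightarrow> f x \<ge> t"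

definition pt_q :: "real \<Rightarrow> 'a \<Rightarrow> real \<Rightarrow> ('a \<Rightarrow> real) \<Rightarrow> bool" where
  "pt_q k x t f \<longleftrightarrow> f x + t + k > 1"

definition pt_in_or_q :: "real \<Rightarrow> 'a \<Rightarrow> real \<Rightarrow> ('a \<Rightarrow> real) \<Rightarrow> bool" where
  "pt_in_or_q k x t f \<longleftrightarrow> pt_in x t f \<or> pt_q k x t f"

definition fuzzy_subgroupoid ::
  "'a set \<Rightarrow> ('a \<Rightarrow> 'a \<Rightarrow> 'a) \<Rightarrow> real \<Rightarrow> ('a \<Rightarrow> real) \<Rightarrow> bool" where
  "fuzzy_subgroupoid S m k f \<longleftrightarrow>
     fuzzy_subset S f \<and>
     (\<forall>x\<in>S. \<forall>y\<in>S. \<forall>t\<in>{0<..1}. \<forall>r\<in>{0<..1}.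
        pt_in x t f \<longrightarrow> pt_in y r f \<longrightarrow> pt_in_or_q k (m x y) (min t r) f)"

definition fuzzy_generalized_bi_ideal ::
  "'a set \<Rightarrow> ('a \<Rightarrow> 'a \<Rightarrow> 'a) \<Rightarrow> real \<Rightarrow> ('a \<Rightarrow> real) \<Rightarrow> bool" where
  "fuzzy_generalized_bi_ideal S m k f \<longleftrightarrow>
     fuzzy_subset S f \<and>
     (\<forall>x\<in>S. \<forall>y\<in>S. \<forall>z\<in>S. \<forall>t\<in>{0<..1}. \<forall>r\<in>{0<..1}.
        pt_in x t f \<longrightarrow> pt_in z r f \<longrightarrow> pt_in_or_q k (m (m x y) z) (min t r) f)"

definition fuzzy_bi_ideal ::
  "'a set \<Rightarrow> ('a \<Rightarrow> 'a \<Rightarrow> 'a) \<Rightarrow> real \<Rightarrow> ('a \<Rightarrow> real) \<Rightarrow> bool" where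
  "fuzzy_bi_ideal S m k f \<longleftrightarrow>
     fuzzy_subgroupoid S m k f \<and> fuzzy_generalized_bi_ideal S m k f"

definition fuzzy_quasi_ideal ::
  "'a set \<Rightarrow> ('a \<Rightarrow> 'a \<Rightarrow> 'a) \<Rightarrow> real \<Rightarrow> ('a \<Rightarrow> real) \<Rightarrow> bool" where
  "fuzzy_quasi_ideal S m k f \<longleftrightarrow>
     fuzzy_subset S f \<and>
     (\<forall>x\<in>S. f x \<ge> min (min (fuzzy_prod S m f fuzzy_one x) (fuzzy_prod S m fuzzy_one f x))
                      ((1 - k) / 2))"

end

theory Submission
  imports Defs
begin

text \<open>The idea is that a weakly regular AG-groupoid with left identity is automatically regular, so
  that the equivalence amounts to the identity \<open>f\<^sub>k = (f \<circ>\<^sub>k 1) \<circ>\<^sub>k f\<close> holding for all the ideals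
  considered. Indeed \<open>a = (ax)(ay)\<close> rewrites to \<open>a = (sa)a\<close> with \<open>s = xy\<close>, and then
  \<open>va = v((sa)a) = (sa)(va) = (av)(as) = a((av)s)\<close>, whence \<open>Sa \<subseteq> aS\<close> and \<open>a = (sa)a \<in> (aS)a\<close>.
  The inclusion \<open>Sa \<subseteq> aS\<close> also places \<open>(uv)c\<close> in both \<open>Sc\<close> and \<open>cS\<close>, so that fuzzy quasi-ideals are
  fuzzy generalized bi-ideals.\<close>

locale ag_groupoid_with_left_identity =
  fixes S :: "'a set" and m :: "'a \<Rightarrow> 'a \<Rightarrow> 'a" (infixl "\<cdot>" 70) and e :: 'a
  assumes ag: "ag_groupoid S m" and left_id: "left_identity S m e"
begin

lemma closed: "a \<in> S \<Longrightarrow> b \<in> S \<Longrightarrow> a \<cdot> b \<in> S"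
  using ag by (simp add: ag_groupoid_def)

lemma left_invertive:
  "a \<in> S \<Longrightarrow> b \<in> S \<Longrightarrow> c \<in> S \<Longrightarrow> (a \<cdot> b) \<cdot> c = (c \<cdot> b) \<cdot> a"
  using ag unfolding ag_groupoid_def by blast

lemma e_closed: "e \<in> S" and e_left: "a \<in> S \<Longrightarrow> e \<cdot> a = a"
  using left_id by (simp_all add: left_identity_def)

text \<open>The left invertive law is used three times: on the outer product, inside it on
  \<open>(c \<cdot> d) \<cdot> b\<close>, and on the outer product again.\<close>

lemma medial:
  assumes "a \<in> S" "b \<in> S" "c \<in> S" "d \<in> S"
  shows "(a \<cdot> b) \<cdot> (c \<cdot> d) = (a \<cdot> c) \<cdot> (b \<cdot> d)"
proof -
  have "(a \<cdot> b) \<cdot> (c \<cdot> d) = ((c \<cdot> d) \<cdot> b) \<cdot> a"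
    using assms by (intro left_invertive closed)
  also have "\<dots> = ((b \<cdot> d) \<cdot> c) \<cdot> a"
    using assms left_invertive[of c d b] by simp
  also have "\<dots> = (a \<cdot> c) \<cdot> (b \<cdot> d)"
    using assms by (intro left_invertive closed)
  finally show ?thesis .
qed

text \<open>This is mediality with \<open>e\<close> as the first factor.\<close>

lemma left_permutable:
  assumes "a \<in> S" "b \<in> S" "c \<in> S"
  shows "a \<cdot> (b \<cdot> c) = b \<cdot> (a \<cdot> c)"
  using medial[of e a b c] assms by (simp add: e_closed e_left closed)

lemma paramedial:
  assumes "a \<in> S" "b \<in> S" "c \<in> S" "d \<in> S"
  shows "(a \<cdot> b) \<cdot> (c \<cdot> d) = (d \<cdot> b) \<cdot> (c \<cdot> a)"
proof -
  have "(a \<cdot> b) \<cdot> (c \<cdot> d) = c \<cdot> ((a \<cdot> b) \<cdot> d)"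
    using assms by (intro left_permutable closed)
  also have "\<dots> = c \<cdot> ((d \<cdot> b) \<cdot> a)"
    using assms left_invertive[of a b d] by simp
  also have "\<dots> = (d \<cdot> b) \<cdot> (c \<cdot> a)"
    using assms by (intro left_permutable closed)
  finally show ?thesis .
qed

lemma weakly_regular_obtain:
  assumes "weakly_regular S m" "a \<in> S"
  obtains s where "s \<in> S" "a = (s \<cdot> a) \<cdot> a"
proof -
  obtain x y where xy: "x \<in> S" "y \<in> S" "a = (a \<cdot> x) \<cdot> (a \<cdot> y)"
    using assms unfolding weakly_regular_def by blast
  \<comment> \<open>The left-hand side \<open>a\<close> recurs on the right of \<open>xy(3)\<close>,
    so equations are chained by \<open>trans\<close>; rewriting with it would loop.\<close>
  have "a = ((a \<cdot> y) \<cdot> x) \<cdot> a"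
    using xy(3) left_invertive[OF assms(2) xy(1) closed[OF assms(2) xy(2)]] by (rule trans)
  also have "(a \<cdot> y) \<cdot> x = (x \<cdot> y) \<cdot> a"
    using xy assms(2) by (intro left_invertive)
  finally show ?thesis
    using that xy(1,2) by (meson closed)
qed

lemma left_multiple_is_right_multiple:
  assumes "weakly_regular S m" "a \<in> S" "v \<in> S"
  obtains w where "w \<in> S" "v \<cdot> a = a \<cdot> w"
proof -
  obtain s where s: "s \<in> S" "a = (s \<cdot> a) \<cdot> a"
    using weakly_regular_obtain[OF assms(1,2)] .
  have "v \<cdot> a = v \<cdot> ((s \<cdot> a) \<cdot> a)"
    using arg_cong[OF s(2), of "m v"] .
  also have "\<dots> = (s \<cdot> a) \<cdot> (v \<cdot> a)"
    using assms s(1) by (intro left_permutable closed)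
  \<comment> \<open>Paramediality exchanges the outer \<open>s\<close> and \<open>a\<close>;
    mediality then puts an \<open>a\<close> at the front of both factors, and left permutability
    pulls the second one out to the left.\<close>
  also have "\<dots> = (a \<cdot> a) \<cdot> (v \<cdot> s)"
    using assms s(1) by (intro paramedial)
  also have "\<dots> = (a \<cdot> v) \<cdot> (a \<cdot> s)"
    using assms s(1) by (intro medial)
  also have "\<dots> = a \<cdot> ((a \<cdot> v) \<cdot> s)"
    using assms s(1) by (intro left_permutable closed)
  finally show ?thesis
    using that assms s(1) by (meson closed)
qed

lemma weakly_regular_imp_regular:
  assumes "weakly_regular S m"
  shows "regular S m"
  unfolding regular_def
proof
  fix a assume a: "a \<in> S"
  obtain s where s: "s \<in> S" "a = (s \<cdot> a) \<cdot> a"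
    using weakly_regular_obtain[OF assms a] .
  obtain x where x: "x \<in> S" "s \<cdot> a = a \<cdot> x"
    using left_multiple_is_right_multiple[OF assms a s(1)] .
  have "a = (a \<cdot> x) \<cdot> a"
    using s(2) unfolding x(2) .
  with x(1) show "\<exists>x\<in>S. a = (a \<cdot> x) \<cdot> a" ..
qed

end

text \<open>A conditional supremum dominates its members only if the set is bounded above; the
  minima here are bounded by 1 because \<open>f\<close> is.\<close>

lemma fuzzy_prod_ge:
  assumes "\<And>x. x \<in> S \<Longrightarrow> f x \<le> 1" "b \<in> S" "c \<in> S" "a = m b c"
  shows "min (f b) (g c) \<le> fuzzy_prod S m f g a"
proof -
  have "bdd_above {min (f b) (g c) | b c. b \<in> S \<and> c \<in> S \<and> a = m b c}"
    using assms(1) by (intro bdd_aboveI[of _ 1]) (auto intro: min.coboundedI1)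
  then show ?thesis
    using assms unfolding fuzzy_prod_def by (auto intro!: cSup_upper)
qed

text \<open>The premise \<open>0 \<le> u\<close> covers an \<open>a\<close> that is not a product,
  where \<open>fuzzy_prod\<close> takes its default value 0.\<close>

lemma fuzzy_prod_le:
  assumes "0 \<le> u" "\<And>b c. b \<in> S \<Longrightarrow> c \<in> S \<Longrightarrow> a = m b c \<Longrightarrow> min (f b) (g c) \<le> u"
  shows "fuzzy_prod S m f g a \<le> u"
proof (cases "\<exists>b\<in>S. \<exists>c\<in>S. a = m b c")
  case True
  then have "Sup {min (f b) (g c) | b c. b \<in> S \<and> c \<in> S \<and> a = m b c} \<le> u"
    using assms(2) by (intro cSup_least) blast+
  with True show ?thesis
    by (simp add: fuzzy_prod_def)
next
  case False
  with assms(1) show ?thesis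
    by (simp add: fuzzy_prod_def)
qed

text \<open>Take both fuzzy points at the level \<open>t\<close> of the left-hand side. In the
  \<open>pt_q\<close> case the value exceeds \<open>1 - k - t\<close>, which is at least
  \<open>t\<close> since \<open>t \<le> (1 - k) / 2\<close>. Levels must be positive, but for
  \<open>t \<le> 0\<close> the claim follows from \<open>0 \<le> f\<close>.\<close>

lemma fuzzy_generalized_bi_ideal_ge:
  assumes "fuzzy_generalized_bi_ideal S m k f" "0 \<le> k" "k < 1"
    and S: "x \<in> S" "y \<in> S" "z \<in> S" "m (m x y) z \<in> S"
  shows "min (min (f x) (f z)) ((1 - k) / 2) \<le> f (m (m x y) z)"
proof -
  define t where "t = min (min (f x) (f z)) ((1 - k) / 2)"
  show ?thesis
  proof (cases "0 < t")
    case True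
    have le: "t \<le> f x" "t \<le> f z" "t \<le> (1 - k) / 2"
      unfolding t_def by linarith+
    then have "t \<in> {0<..1}"
      using True assms(2) by simp
    then have "pt_in_or_q k (m (m x y) z) (min t t) f"
      using assms(1) S le(1,2) unfolding fuzzy_generalized_bi_ideal_def pt_in_def by blast
    then have "t \<le> f (m (m x y) z)"
      using le(3) by (auto simp: pt_in_or_q_def pt_in_def pt_q_def)
    then show ?thesis
      by (simp add: t_def)
  next
    case False
    moreover have "0 \<le> f (m (m x y) z)"
      using assms(1) S by (simp add: fuzzy_generalized_bi_ideal_def fuzzy_subset_def)
    ultimately show ?thesis
      unfolding t_def by linarith
  qed
qed

text \<open>The factorization \<open>a = (a x) a\<close> bounds the product from below. For the
  upper bound, \<open>bi\<close> is applied to every factorization \<open>a = (u v) c\<close>.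
  Generalized bi-ideals and quasi-ideals both enter through \<open>bi\<close>.\<close>

lemma regular_fuzzy_cut_eq:
  assumes reg: "regular S m" and closed: "\<And>a b. a \<in> S \<Longrightarrow> b \<in> S \<Longrightarrow> m a b \<in> S"
    and k: "k < 1" and f: "fuzzy_subset S f"
    and bi: "\<And>x y z. x \<in> S \<Longrightarrow> y \<in> S \<Longrightarrow> z \<in> S \<Longrightarrow>
               min (min (f x) (f z)) ((1 - k) / 2) \<le> f (m (m x y) z)"
  shows "fuzzy_eq S (fuzzy_cut k f) (fuzzy_prod_k S m k (fuzzy_prod_k S m k f fuzzy_one) f)"
  unfolding fuzzy_eq_def
proof
  fix a assume a: "a \<in> S"
  define h where "h = (1 - k) / 2"
  define p where "p = fuzzy_prod_k S m k f fuzzy_one"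
  have f01: "0 \<le> f x" "f x \<le> 1" if "x \<in> S" for x
    using f that by (simp_all add: fuzzy_subset_def)
  have h: "0 \<le> h"
    using k by (simp add: h_def)
  have p_le: "p x \<le> 1" if "x \<in> S" for x
  proof -
    have "fuzzy_prod S m f fuzzy_one x \<le> 1"
      by (rule fuzzy_prod_le) (auto intro: min.coboundedI1 f01)
    then show ?thesis
      by (simp add: p_def fuzzy_prod_k_def min.coboundedI1)
  qed
  have "min (f a) h \<le> fuzzy_prod S m p f a"
  proof -
    obtain x where x: "x \<in> S" "a = m (m a x) a"
      using reg a unfolding regular_def by blast
    have "f a \<le> fuzzy_prod S m f fuzzy_one (m a x)"
      using fuzzy_prod_ge[of S f a x "m a x" m fuzzy_one] a x(1) f01 by (simp add: fuzzy_one_def)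
    then have "min (f a) h \<le> min (p (m a x)) (f a)"
      unfolding p_def fuzzy_prod_k_def h_def by linarith
    also have "\<dots> \<le> fuzzy_prod S m p f a"
      using p_le closed[OF a x(1)] a x(2) by (rule fuzzy_prod_ge)
    finally show ?thesis .
  qed
  moreover have "min (fuzzy_prod S m p f a) h \<le> f a"
  \<comment> \<open>If \<open>h \<le> f a\<close>, the cap \<open>h\<close> already gives the bound;
    otherwise \<open>f a < h\<close>, and \<open>bi\<close> can be used without its cap.\<close>
  proof (cases "h \<le> f a")
    case False
    have "fuzzy_prod S m p f a \<le> f a"
    proof (rule fuzzy_prod_le)
      fix b c assume bc: "b \<in> S" "c \<in> S" "a = m b c"
      show "min (p b) (f c) \<le> f a"
      proof (cases "f c \<le> f a")
        case c: False
        have "fuzzy_prod S m f fuzzy_one b \<le> f a"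
        proof (rule fuzzy_prod_le)
          fix u v assume uv: "u \<in> S" "v \<in> S" "b = m u v"
          have "min (min (f u) (f c)) h \<le> f a"
            using bi[of u v c] uv bc by (simp add: h_def)
          \<comment> \<open>Both \<open>f c\<close> and \<open>h\<close> exceed \<open>f a\<close>,
            so the minimum in \<open>bi\<close> can only be small because of
            \<open>f u\<close>.\<close>
          then have "f u \<le> f a"
            using c False by linarith
          then show "min (f u) (fuzzy_one v) \<le> f a"
            by simp
        qed (use f01 a in simp)
        then show ?thesis
          by (simp add: p_def fuzzy_prod_k_def)
      qed simp
    qed (use f01 a in simp)
    then show ?thesis
      by simp
  qed simp
  \<comment> \<open>Both sides are capped by the same \<open>h\<close>, so the two inequalities give
    equality.\<close>
  ultimately show "fuzzy_cut k f a = fuzzy_prod_k S m k (fuzzy_prod_k S m k f fuzzy_one) f a"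
    by (fold p_def) (auto simp: fuzzy_cut_def fuzzy_prod_k_def simp flip: h_def)
qed

text \<open>Writing \<open>v \<cdot> c\<close> also as \<open>c \<cdot> w\<close> makes both
  products with the constant 1 at least \<open>f c\<close> there, so the quasi-ideal condition
  applies.\<close>

lemma (in ag_groupoid_with_left_identity) fuzzy_quasi_ideal_ge:
  assumes "weakly_regular S m" "fuzzy_quasi_ideal S m k f" "v \<in> S" "c \<in> S"
  shows "min (f c) ((1 - k) / 2) \<le> f (v \<cdot> c)"
proof -
  have f1: "f x \<le> 1" if "x \<in> S" for x
    using assms(2) that by (simp add: fuzzy_quasi_ideal_def fuzzy_subset_def)
  obtain w where w: "w \<in> S" "v \<cdot> c = c \<cdot> w"
    using left_multiple_is_right_multiple[OF assms(1,4,3)] .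
  have "min (f c) (fuzzy_one w) \<le> fuzzy_prod S m f fuzzy_one (v \<cdot> c)"
    using w assms f1 by (intro fuzzy_prod_ge)
  moreover have "min (fuzzy_one v) (f c) \<le> fuzzy_prod S m fuzzy_one f (v \<cdot> c)"
    using assms by (intro fuzzy_prod_ge) (simp_all add: fuzzy_one_def)
  moreover have "min (min (fuzzy_prod S m f fuzzy_one (v \<cdot> c)) (fuzzy_prod S m fuzzy_one f (v \<cdot> c)))
      ((1 - k) / 2) \<le> f (v \<cdot> c)"
    using assms closed unfolding fuzzy_quasi_ideal_def by blast
  ultimately show ?thesis
    using f1[OF assms(4)] by (auto simp: fuzzy_one_def)
qed

theorem theorem17:
  fixes S :: "'a set" and m :: "'a \<Rightarrow> 'a \<Rightarrow> 'a" and e :: 'a and k :: real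
  assumes "0 \<le> k" and "k < 1"
    and "ag_groupoid S m"
    and "weakly_regular S m"
    and "left_identity S m e"
  shows "(regular S m \<longleftrightarrow>
            (\<forall>f. fuzzy_generalized_bi_ideal S m k f \<longrightarrow>
               fuzzy_eq S (fuzzy_cut k f) (fuzzy_prod_k S m k (fuzzy_prod_k S m k f fuzzy_one) f)))
       \<and> (regular S m \<longleftrightarrow>
            (\<forall>f. fuzzy_bi_ideal S m k f \<longrightarrow>
               fuzzy_eq S (fuzzy_cut k f) (fuzzy_prod_k S m k (fuzzy_prod_k S m k f fuzzy_one) f)))
       \<and> (regular S m \<longleftrightarrow>
            (\<forall>f. fuzzy_quasi_ideal S m k f \<longrightarrow>
               fuzzy_eq S (fuzzy_cut k f) (fuzzy_prod_k S m k (fuzzy_prod_k S m k f fuzzy_one) f)))"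
proof -
  interpret ag_groupoid_with_left_identity S m e
    using assms(3,5) by unfold_locales
  have reg: "regular S m"
    using assms(4) by (rule weakly_regular_imp_regular)
  have gen: "fuzzy_eq S (fuzzy_cut k f) (fuzzy_prod_k S m k (fuzzy_prod_k S m k f fuzzy_one) f)"
    if "fuzzy_generalized_bi_ideal S m k f" for f
  proof (rule regular_fuzzy_cut_eq[OF reg closed assms(2)])
    show "fuzzy_subset S f"
      using that by (simp add: fuzzy_generalized_bi_ideal_def)
    show "min (min (f x) (f z)) ((1 - k) / 2) \<le> f (m (m x y) z)"
      if "x \<in> S" "y \<in> S" "z \<in> S" for x y z
      using that
      by (intro fuzzy_generalized_bi_ideal_ge[OF \<open>fuzzy_generalized_bi_ideal S m k f\<close> assms(1,2)] closed)
  qed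
  have quasi: "fuzzy_eq S (fuzzy_cut k f) (fuzzy_prod_k S m k (fuzzy_prod_k S m k f fuzzy_one) f)"
    if "fuzzy_quasi_ideal S m k f" for f
  proof (rule regular_fuzzy_cut_eq[OF reg closed assms(2)])
    show "fuzzy_subset S f"
      using that by (simp add: fuzzy_quasi_ideal_def)
    show "min (min (f x) (f z)) ((1 - k) / 2) \<le> f (m (m x y) z)"
      if "x \<in> S" "y \<in> S" "z \<in> S" for x y z
      \<comment> \<open>With \<open>m x y\<close> as the left factor,
        \<open>min (f z) ((1 - k) / 2)\<close> is already a lower bound; including
        \<open>f x\<close> in the minimum only lowers it.\<close>
      using fuzzy_quasi_ideal_ge[OF assms(4) \<open>fuzzy_quasi_ideal S m k f\<close> closed[OF that(1,2)] that(3)]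
      by linarith
  qed
  \<comment> \<open>Every bi-ideal is by definition a generalized bi-ideal, so \<open>gen\<close>
    settles the second equivalence too.\<close>
  show ?thesis
    using reg gen quasi by (auto simp: fuzzy_bi_ideal_def)
qed

end
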